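(* For all natural numbers $m,l \ge 4$, $$h(m,l) \le \binom{m+l-4}{l-2}-\binom{m+l-6}{l-3},$$ where $h$ is the convexification function defined in the context.
   Context: All point sets are finite, in the plane, non-vertical (no vertical line contains two of the points) and in general position (no three points collinear), including unions of two sets under consideration. Points $(x_1,y_1),\dots,(x_k,y_k)$ form a $k$-cup if $x_1<\dots<x_k$ and the slopes $\frac{y_{i+1}-y_i}{x_{i+1}-x_i}$ are strictly increasing; they form a $k$-cap if $x_1<\dots<x_k$ and these slopes are strictly decreasing. For $m,l\ge 3$ a set is $(m,l)$-free if it contains no $m$-cup and no $l$-cap. A convex $n$-gon means $n$ points of the set in convex position. For $m,l \ge 3$, a point $s$ of a set $S$ is an $(m,l)$-convexifying point for $S$ if $s$ is the leftmost point of an $(l-1)$-cap in $S$ and, for every natural number $n\ge 4$ and every set $B$ with $B\cap S=\emptyset$ such that $B\cup S$ contains an $(n-1)$-cup whose left endpoint is $s$ and whose right endpoint is in $B$, the set $B\cup S$ contains at least one of: an $m$-cup whose two leftmost points belong to $S$; an $l$-cap whose two rightmost points belong to $S$; a convex $n$-gon. The convexification function $h(m,l)$ is the maximum number such that there exists an $(m,l)$-free set of $h(m,l)$ points with no $(m,l)$-convexifying point. *)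

theory Defs
  imports "HOL-Analysis.Analysis"
begin

definition admissible :: "(real \<times> real) set \<Rightarrow> bool" where
  "admissible S \<longleftrightarrow> finite S \<and> inj_on fst S \<and>
     (\<forall>p\<in>S. \<forall>q\<in>S. \<forall>r\<in>S. p \<noteq> q \<and> q \<noteq> r \<and> p \<noteq> r \<longrightarrow> \<not> collinear {p, q, r})"

definition slope :: "real \<times> real \<Rightarrow> real \<times> real \<Rightarrow> real" where
  "slope p q = (snd q - snd p) / (fst q - fst p)"

definition slopes :: "(real \<times> real) list \<Rightarrow> real list" where
  "slopes ps = map2 slope ps (tl ps)"

text \<open>Cups and caps are represented by the list of their points from left to right, so that
  \<^term>\<open>hd\<close> and \<^term>\<open>last\<close> give the left and right endpoints.\<close>

definition is_cup :: "nat \<Rightarrow> (real \<times> real) list \<Rightarrow> bool" where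
  "is_cup k ps \<longleftrightarrow> length ps = k \<and> sorted_wrt (<) (map fst ps) \<and> sorted_wrt (<) (slopes ps)"

definition is_cap :: "nat \<Rightarrow> (real \<times> real) list \<Rightarrow> bool" where
  "is_cap k ps \<longleftrightarrow> length ps = k \<and> sorted_wrt (<) (map fst ps) \<and> sorted_wrt (>) (slopes ps)"

definition cup_cap_free :: "nat \<Rightarrow> nat \<Rightarrow> (real \<times> real) set \<Rightarrow> bool" where
  "cup_cap_free m l S \<longleftrightarrow>
     \<not> (\<exists>ps. is_cup m ps \<and> set ps \<subseteq> S) \<and> \<not> (\<exists>ps. is_cap l ps \<and> set ps \<subseteq> S)"

definition convex_position :: "(real \<times> real) set \<Rightarrow> bool" where
  "convex_position T \<longleftrightarrow> (\<forall>p\<in>T. p \<notin> convex hull (T - {p}))"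

definition contains_convex_gon :: "nat \<Rightarrow> (real \<times> real) set \<Rightarrow> bool" where
  "contains_convex_gon n S \<longleftrightarrow> (\<exists>T\<subseteq>S. finite T \<and> card T = n \<and> convex_position T)"

definition convexifying_point ::
    "nat \<Rightarrow> nat \<Rightarrow> (real \<times> real) set \<Rightarrow> real \<times> real \<Rightarrow> bool" where
  "convexifying_point m l S s \<longleftrightarrow> s \<in> S \<and>
     (\<exists>ps. is_cap (l - 1) ps \<and> set ps \<subseteq> S \<and> hd ps = s) \<and>
     (\<forall>n B. n \<ge> 4 \<and> B \<inter> S = {} \<and> admissible (B \<union> S) \<and>
        (\<exists>ps. is_cup (n - 1) ps \<and> set ps \<subseteq> B \<union> S \<and> hd ps = s \<and> last ps \<in> B) \<longrightarrow>
        (\<exists>ps. is_cup m ps \<and> set ps \<subseteq> B \<union> S \<and> ps ! 0 \<in> S \<and> ps ! 1 \<in> S) \<or>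
        (\<exists>ps. is_cap l ps \<and> set ps \<subseteq> B \<union> S \<and> ps ! (l - 2) \<in> S \<and> ps ! (l - 1) \<in> S) \<or>
        contains_convex_gon n (B \<union> S))"

text \<open>The set below contains 0 (take the empty set for \<open>S\<close>) and, for \<open>m, l \<ge> 3\<close>, is bounded by the
  Erdos-Szekeres bound \<open>(m + l - 4) choose (l - 2)\<close> on the size of \<open>(m, l)\<close>-free sets, so its
  maximum exists.\<close>

definition convexification :: "nat \<Rightarrow> nat \<Rightarrow> nat" where
  "convexification m l =
     Max {card S | S. admissible S \<and> cup_cap_free m l S \<and> \<not> (\<exists>s. convexifying_point m l S s)}"

end

theory Submission imports Defs begin

text \<open>Write \<open>f m l = (m + l - 4) choose (l - 2)\<close> for the Erdos--Szekeres bound, and let \<open>A\<close> be the set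
  of left endpoints of \<open>(l - 1)\<close>-caps of \<open>S\<close>. Then \<open>S - A\<close> is \<open>(m, l - 1)\<close>-free. A point \<open>s\<close> of \<open>A\<close>
  that is also the right endpoint of an \<open>(m - 2)\<close>-cup is convexifying, so without convexifying
  points \<open>A\<close> is even \<open>(m - 2, l)\<close>-free, and \<open>f (m - 2) l + f m (l - 1)\<close> equals
  \<open>f m l - f (m - 1) (l - 1)\<close>.

  To see that \<open>s\<close> is convexifying, let \<open>q\<close> precede \<open>s\<close> in the \<open>(m - 2)\<close>-cup, let \<open>c\<close> follow \<open>s\<close>
  in the \<open>(l - 1)\<close>-cap, and let \<open>y, r\<close> be the last two points of the given \<open>(n - 1)\<close>-cup. Since \<open>S\<close>
  has no \<open>l\<close>-cap, \<open>q, s, c\<close> is a cup. The position of \<open>c\<close> relative to the \<open>(n - 1)\<close>-cup then decides: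
  either two of its points extend the \<open>(m - 2)\<close>-cup (one of them possibly replaced by \<open>c\<close>), or two
  consecutive points of it replace \<open>s\<close> at the front of the \<open>(l - 1)\<close>-cap, or \<open>c\<close> completes it to a
  convex \<open>n\<close>-gon.\<close>

section \<open>Cups and caps as lists with monotone slopes\<close>

text \<open>Cups and caps are the instances \<open>(<)\<close> and \<open>(>)\<close>, so extending
  and splitting is proved once for both. The length is left out, so that pieces of a chain are again
  chains.\<close>

definition chain :: "(real \<Rightarrow> real \<Rightarrow> bool) \<Rightarrow> (real \<times> real) list \<Rightarrow> bool" where
  "chain R ps \<longleftrightarrow> sorted_wrt (<) (map fst ps) \<and> sorted_wrt R (slopes ps)"

lemma is_cup_iff_chain: "is_cup k ps \<longleftrightarrow> length ps = k \<and> chain (<) ps"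
  by (simp add: is_cup_def chain_def)

lemma is_cap_iff_chain: "is_cap k ps \<longleftrightarrow> length ps = k \<and> chain (>) ps"
  by (simp add: is_cap_def chain_def)

lemma slopes_simps [simp]:
  "slopes [] = []" "slopes [a] = []" "slopes (a # b # ps) = slope a b # slopes (b # ps)"
  by (simp_all add: slopes_def)

lemma chain_Nil [simp]: "chain R []"
  and chain_single [simp]: "chain R [a]"
  and chain_pair [simp]: "chain R [a, b] \<longleftrightarrow> fst a < fst b"
  by (simp_all add: chain_def)

lemma transp_gt_real: "transp ((>) :: real \<Rightarrow> real \<Rightarrow> bool)"
  by (auto simp: transp_def)

lemma chain_Cons3:
  assumes "transp R"
  shows "chain R (a # b # c # ps) \<longleftrightarrow>
    fst a < fst b \<and> R (slope a b) (slope b c) \<and> chain R (b # c # ps)"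
  using assms by (auto simp: chain_def sorted_wrt2 simp del: sorted_wrt.simps)

text \<open>Mirror image of \<open>chain_Cons3\<close>: later on, cups grow at the right end and
  caps at the left end.\<close>

lemma chain_snoc3:
  assumes "transp R"
  shows "chain R (ps @ [a, b, c]) \<longleftrightarrow>
    chain R (ps @ [a, b]) \<and> R (slope a b) (slope b c) \<and> fst b < fst c"
proof (induction ps)
  case Nil
  then show ?case by (auto simp: chain_Cons3[OF assms])
next
  case (Cons x ps)
  show ?case
  proof (cases ps)
    case Nil
    then show ?thesis by (auto simp: chain_Cons3[OF assms])
  next
    case (Cons y zs)
    then show ?thesis
      using Cons.IH by (cases zs) (auto simp: chain_Cons3[OF assms])
  qed
qed

lemmas cup_Cons3 = chain_Cons3[OF transp_on_less]
  and cup_snoc3 = chain_snoc3[OF transp_on_less]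
  and cap_Cons3 = chain_Cons3[OF transp_gt_real]

lemma set_slopes_prefix: "set (slopes ps) \<subseteq> set (slopes (ps @ qs))"
proof (induction ps)
  case (Cons a ps)
  then show ?case by (cases ps) auto
qed simp

lemma chain_append:
  assumes "chain R (ps @ qs)"
  shows "chain R ps" and "chain R qs"
proof -
  have "chain R ps \<and> chain R qs"
    using assms
  proof (induction ps)
    case (Cons a ps)
    then show ?case
      using set_slopes_prefix[of ps qs] by (cases ps; cases qs) (auto simp: chain_def)
  qed simp
  then show "chain R ps" "chain R qs" by auto
qed

lemma chain_distinct: "chain R ps \<Longrightarrow> distinct ps"
  by (metis chain_def distinct_map strict_sorted_iff)

section \<open>Slope comparisons, general position and supporting lines\<close>

text \<open>\<open>slope a c\<close> is the mean of \<open>slope a b\<close> and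
  \<open>slope b c\<close>, weighted by the horizontal lengths, so it lies between them.\<close>

lemma slope_mediant:
  assumes "fst a < fst b" "fst b < fst c"
  shows "slope a b < slope a c \<longleftrightarrow> slope a b < slope b c"
    and "slope a c < slope b c \<longleftrightarrow> slope a b < slope b c"
    and "slope a c < slope a b \<longleftrightarrow> slope b c < slope a b"
  using assms by (auto simp: slope_def field_simps)

text \<open>All differences of the three points are multiples of
  \<open>(1, slope a b)\<close>.\<close>

lemma collinear_if_slope_eq:
  assumes "fst a < fst b" "fst b < fst c" "slope a b = slope b c"
  shows "collinear {a, b, c}"
proof -
  have "snd b - snd a = slope a b * (fst b - fst a)" "snd c - snd b = slope b c * (fst c - fst b)"
    using assms(1,2) by (auto simp: slope_def)
  then have "x - y = (fst x - fst y) *\<^sub>R (1, slope a b)" if "x \<in> {a, b, c}" "y \<in> {a, b, c}" for x y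
    using that assms(3) by (auto simp: prod_eq_iff algebra_simps)
  then show ?thesis unfolding collinear_def by blast
qed

text \<open>Turns each comparison of adjacent slopes into a strict dichotomy.\<close>

lemma admissible_slope_neq:
  assumes "admissible S" "a \<in> S" "b \<in> S" "c \<in> S" "fst a < fst b" "fst b < fst c"
  shows "slope a b \<noteq> slope b c"
proof -
  have "a \<noteq> b" "b \<noteq> c" "a \<noteq> c" using assms by auto
  then show ?thesis
    using assms collinear_if_slope_eq[of a b c] unfolding admissible_def by blast
qed

lemma admissible_fst_neq:
  assumes "admissible S" "a \<in> S" "b \<in> S" "a \<noteq> b"
  shows "fst a \<noteq> fst b"
  using assms unfolding admissible_def inj_on_def by blast

lemma admissible_subset: "admissible S \<Longrightarrow> T \<subseteq> S \<Longrightarrow> admissible T"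
  unfolding admissible_def by (meson finite_subset inj_on_subset subsetD)

text \<open>Induction along the cup: \<open>slope b z\<close> is a mean of \<open>slope b c\<close>
  and \<open>slope c z\<close>, and the latter is the larger one by induction.\<close>

lemma cup_slope_right:
  assumes "chain (<) (a # b # ps)" "z \<in> set ps"
  shows "slope a b < slope b z"
  using assms
proof (induction ps arbitrary: a b)
  case (Cons c ps)
  have *: "slope a b < slope b c" "fst b < fst c" "chain (<) (b # c # ps)"
    using Cons.prems by (auto simp: cup_Cons3 chain_def)
  show ?case
  proof (cases "z = c")
    case False
    then have "z \<in> set ps" using Cons.prems by auto
    moreover from this have "fst c < fst z" using *(3) by (auto simp: chain_def)
    ultimately show ?thesis
      using Cons.IH[OF *(3)] * slope_mediant(1)[of b c z] by auto
  qed (use * in auto)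
qed simp

lemma cup_slope_left:
  assumes "chain (<) (ps @ [a, b])" "z \<in> set ps"
  shows "slope z a < slope a b"
  using assms
proof (induction ps arbitrary: a b rule: rev_induct)
  case (snoc c ps)
  have *: "slope c a < slope a b" "fst c < fst a" "chain (<) (ps @ [c, a])"
    using snoc.prems(1) cup_snoc3[of ps c a b] by (auto simp: chain_def sorted_wrt_append)
  show ?case
  proof (cases "z = c")
    case False
    then have "z \<in> set ps" using snoc.prems by auto
    moreover from this have "fst z < fst c" using *(3) by (auto simp: chain_def sorted_wrt_append)
    ultimately show ?thesis
      using snoc.IH[OF *(3)] * slope_mediant(2)[of z c a] by auto
  qed (use * in auto)
qed simp

lemma chain_fst_less:
  assumes "chain R (xs @ p # ys)"
  shows "x \<in> set xs \<Longrightarrow> fst x < fst p" and "y \<in> set ys \<Longrightarrow> fst p < fst y"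
  using assms by (auto simp: chain_def sorted_wrt_append)

text \<open>The line of slope \<open>t\<close> through \<open>p\<close> supports the cup: all other
  points lie strictly above it. Of the slopes into \<open>p\<close> from the left, that of the
  adjacent edge is the largest; of those out of \<open>p\<close>, that of the adjacent edge is the
  smallest. Any \<open>t\<close> strictly between these two works.\<close>

lemma cup_tangent:
  assumes "chain (<) (xs @ p # ys)" "xs \<noteq> []" "ys \<noteq> []"
  obtains t where "\<And>x. x \<in> set xs \<Longrightarrow> slope x p < t" and "\<And>y. y \<in> set ys \<Longrightarrow> t < slope p y"
proof -
  obtain xs' a where xs: "xs = xs' @ [a]" using assms(2) by (metis rev_exhaust)
  obtain b ys' where ys: "ys = b # ys'" using assms(3) by (meson neq_Nil_conv)
  have left: "chain (<) (xs' @ [a, p])" and "chain (<) (a # p # b # ys')"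
    using assms(1) chain_append(1)[of _ "xs' @ [a, p]" ys] chain_append(2)[of _ xs' "a # p # ys"]
    by (auto simp: xs ys)
  then have right: "chain (<) (p # b # ys')" and ab: "slope a p < slope p b"
    by (auto simp: cup_Cons3)
  have L: "slope z a < slope a p" if "z \<in> set xs'" for z
    using cup_slope_left[OF left that] .
  have R: "slope p b < slope b z" if "z \<in> set ys'" for z
    using cup_slope_right[OF right that] .
  have L': "slope x p \<le> slope a p" if "x \<in> set xs" for x
  proof (cases "x = a")
    case False
    then have "x \<in> set xs'" using that xs by simp
    moreover from this have "fst x < fst a" "fst a < fst p"
      using left by (auto simp: chain_def sorted_wrt_append)
    ultimately show ?thesis using L slope_mediant(2)[of x a p] by auto
  qed simp
  have R': "slope p b \<le> slope p y" if "y \<in> set ys" for y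
  proof (cases "y = b")
    case False
    then have "y \<in> set ys'" using that ys by simp
    moreover from this have "fst p < fst b" "fst b < fst y"
      using right by (auto simp: chain_def)
    ultimately show ?thesis using R slope_mediant(1)[of p b y] by auto
  qed simp
  show thesis
  proof (rule that[of "(slope a p + slope p b) / 2"])
    show "slope x p < (slope a p + slope p b) / 2" if "x \<in> set xs" for x
      using L'[OF that] ab by (simp add: field_simps)
    show "(slope a p + slope p b) / 2 < slope p y" if "y \<in> set ys" for y
      using R'[OF that] ab by (simp add: field_simps)
  qed
qed

lemma cup_triple:
  assumes "chain (<) (xs @ p # ys)" "x \<in> set xs" "y \<in> set ys"
  shows "slope x p < slope p y"
proof -
  have "xs \<noteq> []" "ys \<noteq> []" using assms by auto
  then obtain t where "slope x p < t" "t < slope p y"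
    using cup_tangent[OF assms(1)] assms(2,3) by metis
  then show ?thesis by simp
qed

section \<open>Convex position of cups, with or without a point above the chord\<close>

text \<open>Rewrites slope comparisons as values of the linear functional
  \<open>snd z - t * fst z\<close>, the form needed for separating half-planes.\<close>

lemma slope_less_iff:
  assumes "fst a < fst b"
  shows "slope a b < t \<longleftrightarrow> snd b - t * fst b < snd a - t * fst a"
    and "t < slope a b \<longleftrightarrow> snd a - t * fst a < snd b - t * fst b"
  using assms by (auto simp: slope_def field_simps)

lemma not_in_hull_halfspace:
  fixes p :: "'a::euclidean_space"
  assumes "\<And>z. z \<in> T \<Longrightarrow> v \<bullet> p < v \<bullet> z"
  shows "p \<notin> convex hull T"
proof
  assume "p \<in> convex hull T"
  moreover have "convex hull T \<subseteq> {z. v \<bullet> p < v \<bullet> z}"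
    by (intro hull_minimal) (use assms in \<open>auto simp: convex_halfspace_gt\<close>)
  ultimately show False by auto
qed

lemma convex_position_subset: "convex_position T \<Longrightarrow> U \<subseteq> T \<Longrightarrow> convex_position U"
  unfolding convex_position_def by (meson Diff_mono hull_mono order_refl subsetD)

text \<open>The assumption \<open>above\<close> puts \<open>u\<close> above the chord from
  \<open>s\<close> to \<open>r\<close>, and \<open>ps\<close> lies below it. Each point is cut off
  from the others by a line: \<open>u\<close> by one parallel to the chord, the ends by vertical
  lines, an inner point by the tangent of the cup there.\<close>

lemma convex_position_cup_insert:
  assumes cup: "chain (<) (s # ps @ [r])" and "fst s < fst u" "fst u < fst r"
    and above: "slope u r < slope s u"
  shows "convex_position (insert u (set (s # ps @ [r])))"
  unfolding convex_position_def
proof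
  let ?C = "set (s # ps @ [r])"
  fix p assume p: "p \<in> insert u ?C"
  have ps: "fst s < fst z" "fst z < fst r" "slope s z < slope z r" if z: "z \<in> set ps" for z
  proof -
    obtain xs ys where "ps = xs @ z # ys" using z by (meson split_list)
    then have *: "chain (<) ((s # xs) @ z # (ys @ [r]))" using cup by simp
    show "fst s < fst z" "fst z < fst r" "slope s z < slope z r"
      using chain_fst_less[OF *] cup_triple[OF *] by auto
  qed
  have sr: "fst s < fst r" using assms by auto
  define k where "k = slope s r"
  have k: "snd s - k * fst s = snd r - k * fst r"
    using sr by (simp add: k_def slope_def field_simps)
  have uk: "snd s - k * fst s < snd u - k * fst u"
    using slope_mediant(3)[of s u r] assms slope_less_iff(2)[of s u k] by (auto simp: k_def)
  have psk: "snd z - k * fst z < snd s - k * fst s" if "z \<in> set ps" for z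
    using slope_mediant(1)[of s z r] ps[OF that] slope_less_iff(1)[of s z k] by (auto simp: k_def)
  consider "p = u" | "p = s" | "p = r" | "p \<in> set ps" using p by auto
  then show "p \<notin> convex hull (insert u ?C - {p})"
  proof cases
    case 1
    then show ?thesis
      using uk psk k
      by (intro not_in_hull_halfspace[where v = "(k, -1)"])
        (fastforce simp: inner_prod_def)
  next
    case 2
    then show ?thesis
      using assms sr ps
      by (intro not_in_hull_halfspace[where v = "(1, 0)"]) (auto simp: inner_prod_def)
  next
    case 3
    then show ?thesis
      using assms sr ps
      by (intro not_in_hull_halfspace[where v = "(-1, 0)"]) (auto simp: inner_prod_def)
  next
    case 4
    obtain xs ys where split: "ps = xs @ p # ys" using 4 by (meson split_list)
    then have *: "chain (<) ((s # xs) @ p # (ys @ [r]))" using cup by simp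
    obtain t where t: "\<And>x. x \<in> set (s # xs) \<Longrightarrow> slope x p < t"
      "\<And>y. y \<in> set (ys @ [r]) \<Longrightarrow> t < slope p y"
      using cup_tangent[OF *] by auto
    have L: "snd p - t * fst p < snd x - t * fst x" if "x \<in> set (s # xs)" for x
      using t(1)[OF that] chain_fst_less(1)[OF * that] slope_less_iff(1)[of x p t] by auto
    have R: "snd p - t * fst p < snd x - t * fst x" if "x \<in> set (ys @ [r])" for x
      using t(2)[OF that] chain_fst_less(2)[OF * that] slope_less_iff(2)[of p x t] by auto
    \<comment> \<open>Both chord ends lie above the tangent at \<open>p\<close>, and
      \<open>u\<close> lies above the chord. In the direction \<open>t\<close> it is enough to
      compare \<open>u\<close> with the lower chord end: \<open>s\<close> if
      \<open>t \<le> k\<close>, otherwise \<open>r\<close>.\<close>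
    have U: "snd p - t * fst p < snd u - t * fst u"
    proof (cases "t \<le> k")
      case True
      have "(k - t) * fst s \<le> (k - t) * fst u" using True assms by (intro mult_left_mono) auto
      then show ?thesis using L[of s] uk by (simp add: algebra_simps)
    next
      case False
      have "(t - k) * fst u \<le> (t - k) * fst r" using False assms by (intro mult_left_mono) auto
      then show ?thesis using R[of r] uk k by (simp add: algebra_simps)
    qed
    have "snd p - t * fst p < snd z - t * fst z" if "z \<in> insert u ?C - {p}" for z
      using that L R U by (auto simp: split)
    then show ?thesis
      by (intro not_in_hull_halfspace[where v = "(-t, 1)"]) (auto simp: inner_prod_def)
  qed
qed

text \<open>An auxiliary point \<open>u\<close>, one unit above the midpoint of the chord, is
  inserted and then dropped again.\<close>

lemma convex_position_cup:
  assumes "chain (<) (s # ps @ [r])"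
  shows "convex_position (set (s # ps @ [r]))"
proof -
  have "fst s < fst r" using assms by (auto simp: chain_def sorted_wrt_append)
  define u where "u = ((fst s + fst r) / 2, (snd s + snd r) / 2 + 1)"
  have "fst s < fst u" "fst u < fst r" "slope u r < slope s u"
    using \<open>fst s < fst r\<close> by (auto simp: u_def slope_def field_simps)
  then show ?thesis
    using convex_position_cup_insert[OF assms] convex_position_subset by blast
qed

section \<open>Counting by left endpoints of caps, and the Erdos-Szekeres bound\<close>

definition cap_starts :: "nat \<Rightarrow> (real \<times> real) set \<Rightarrow> (real \<times> real) set" where
  "cap_starts k S = {s \<in> S. \<exists>ps. is_cap k ps \<and> set ps \<subseteq> S \<and> hd ps = s}"

text \<open>Outside \<open>cap_starts l S\<close> there is no \<open>l\<close>-cap, as its left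
  endpoint would belong to that set. The parameter \<open>k\<close> is left open:
  \<open>k = m - 1\<close> gives the classical recursion, \<open>k = m - 2\<close> the final
  count.\<close>

lemma card_cup_cap_free_le_cap_starts:
  assumes "admissible S" "cup_cap_free m (Suc l) S"
    and "\<And>ps. is_cup k ps \<Longrightarrow> \<not> set ps \<subseteq> cap_starts l S"
    and "1 \<le> l"
    and bound1: "\<And>T. admissible T \<Longrightarrow> cup_cap_free k (Suc l) T \<Longrightarrow> card T \<le> b1"
    and bound2: "\<And>T. admissible T \<Longrightarrow> cup_cap_free m l T \<Longrightarrow> card T \<le> b2"
  shows "card S \<le> b1 + b2"
proof -
  let ?A = "cap_starts l S"
  have sub: "?A \<subseteq> S" by (auto simp: cap_starts_def)
  have "cup_cap_free k (Suc l) ?A"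
    using assms(2,3) sub unfolding cup_cap_free_def by blast
  then have 1: "card ?A \<le> b1" using bound1 admissible_subset[OF assms(1) sub] by auto
  have "\<not> set ps \<subseteq> S - ?A" if "is_cap l ps" for ps
  proof
    assume ps: "set ps \<subseteq> S - ?A"
    \<comment> \<open>\<open>hd\<close> is meaningful only for a nonempty cap, hence
      \<open>1 \<le> l\<close>.\<close>
    have "ps \<noteq> []" using that \<open>1 \<le> l\<close> by (auto simp: is_cap_def)
    then have "hd ps \<in> S - ?A" using ps hd_in_set by blast
    then have "hd ps \<in> ?A" using ps that by (auto simp: cap_starts_def)
    with \<open>hd ps \<in> S - ?A\<close> show False by auto
  qed
  then have "cup_cap_free m l (S - ?A)"
    using assms(2) unfolding cup_cap_free_def by blast
  then have 2: "card (S - ?A) \<le> b2" using bound2 admissible_subset[OF assms(1)] by auto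
  have "finite S" using assms(1) by (simp add: admissible_def)
  then have "card S = card ?A + card (S - ?A)"
    using sub by (metis add.commute card_Diff_subset card_mono finite_subset le_add_diff_inverse2)
  with 1 2 show ?thesis by simp
qed

lemma card_le_1_if_no_pair:
  assumes "admissible S" "\<And>a b. a \<in> S \<Longrightarrow> b \<in> S \<Longrightarrow> \<not> fst a < fst b"
  shows "card S \<le> 1"
proof -
  have "\<forall>a\<in>S. \<forall>b\<in>S. a = b"
    using assms admissible_fst_neq by (metis linorder_neqE_linordered_idom)
  then show ?thesis
    using assms(1) by (simp add: card_le_Suc0_iff_eq admissible_def)
qed

lemma cup_snoc2E:
  assumes "is_cup k ps" "2 \<le> k"
  obtains qs q s where "ps = qs @ [q, s]" "chain (<) (qs @ [q, s])" "fst q < fst s"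
proof -
  obtain xs s where 1: "ps = xs @ [s]" using assms by (cases ps rule: rev_cases) (auto simp: is_cup_def)
  obtain qs q where 2: "xs = qs @ [q]"
    using assms 1 by (cases xs rule: rev_cases) (auto simp: is_cup_def)
  show thesis
    using that[of qs q s] 1 2 assms by (auto simp: is_cup_iff_chain chain_def sorted_wrt_append)
qed

lemma cap_Cons2E:
  assumes "is_cap k ps" "2 \<le> k"
  obtains c d cs where "ps = c # d # cs" "chain (>) (c # d # cs)" "fst c < fst d"
proof -
  obtain c d cs where "ps = c # d # cs"
    using assms by (cases ps; cases "tl ps") (auto simp: is_cap_def)
  then show thesis using that assms by (auto simp: is_cap_iff_chain chain_def)
qed

text \<open>With both parameters shifted by 2 the recursion is Pascal's rule. Where the last point
  of a cup starts a cap, the slopes of the two edges meeting there decide whether the cup or the cap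
  grows by one point.\<close>

theorem erdos_szekeres_cup_cap:
  assumes "admissible S" "cup_cap_free (a + 2) (b + 2) S"
  shows "card S \<le> (a + b) choose b"
  using assms
proof (induction "a + b" arbitrary: a b S rule: less_induct)
  case less
  show ?case
  proof (cases "a = 0 \<or> b = 0")
    case True
    \<comment> \<open>Two points form both a 2-cup and a 2-cap.\<close>
    have "\<not> fst x < fst y" if "x \<in> S" "y \<in> S" for x y
      using True less.prems(2) that
      by (auto simp: cup_cap_free_def is_cup_iff_chain is_cap_iff_chain numeral_2_eq_2
          dest!: spec[of _ "[x, y]"])
    then have "card S \<le> 1" using card_le_1_if_no_pair less.prems by blast
    then show ?thesis using True by auto
  next
    case False
    then obtain a' b' where ab: "a = Suc a'" "b = Suc b'" by (metis not0_implies_Suc)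
    have "card S \<le> ((a' + b) choose b) + ((a + b') choose b')"
    proof (rule card_cup_cap_free_le_cap_starts[where m = "a + 2" and k = "a' + 2" and l = "b' + 2"])
      show "cup_cap_free (a + 2) (Suc (b' + 2)) S" using less.prems ab by simp
      show "card T \<le> (a' + b choose b)" if "admissible T" "cup_cap_free (a' + 2) (Suc (b' + 2)) T" for T
        using less.hyps[of a' b T] that ab by simp
      show "card T \<le> (a + b' choose b')" if "admissible T" "cup_cap_free (a + 2) (b' + 2) T" for T
        using less.hyps[of a b' T] that ab by simp
      show "\<not> set ps \<subseteq> cap_starts (b' + 2) S" if ps: "is_cup (a' + 2) ps" for ps
      proof
        assume sub: "set ps \<subseteq> cap_starts (b' + 2) S"
        obtain qs q s where qs: "ps = qs @ [q, s]" "chain (<) (qs @ [q, s])" "fst q < fst s"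
          using cup_snoc2E[OF ps] by (metis le_add2)
        obtain cs where "is_cap (b' + 2) cs" "set cs \<subseteq> S" "hd cs = s"
          using sub qs by (auto simp: cap_starts_def)
        moreover from this obtain d ds where cs: "cs = s # d # ds" "chain (>) (s # d # ds)" "fst s < fst d"
          using cap_Cons2E[of "b' + 2" cs] by (metis le_add2 list.sel(1))
        ultimately have S: "set (qs @ [q, s]) \<subseteq> S" "set (s # d # ds) \<subseteq> S"
          and len: "length (qs @ [q, s]) = a' + 2" "length (s # d # ds) = b' + 2"
          using sub qs ps by (auto simp: cap_starts_def is_cup_def is_cap_def)
        then have "slope q s \<noteq> slope s d"
          using admissible_slope_neq[OF less.prems(1)] qs cs by auto
        then consider "slope q s < slope s d" | "slope q s > slope s d" by linarith
        then show False
        proof cases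
          case 1
          then have "is_cup (a + 2) (qs @ [q, s, d])"
            using len ab qs cs by (auto simp: is_cup_iff_chain cup_snoc3)
          then show False using less.prems(2) S unfolding cup_cap_free_def by fastforce
        next
          case 2
          then have "is_cap (b + 2) (q # s # d # ds)"
            using len ab qs cs by (auto simp: is_cap_iff_chain cap_Cons3)
          then show False using less.prems(2) S unfolding cup_cap_free_def by fastforce
        qed
      qed
    qed (use less.prems in auto)
    then show ?thesis using ab by simp
  qed
qed

section \<open>Ends of \<open>(m - 2)\<close>-cups that start \<open>(l - 1)\<close>-caps are
  convexifying\<close>

lemma convexifying_point_if_cup_end_and_cap_start:
  assumes S: "admissible S" "cup_cap_free m l S" and "4 \<le> m" "4 \<le> l"
    and cup: "is_cup (m - 2) (qs @ [q, s])" "set (qs @ [q, s]) \<subseteq> S"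
    and cap: "s \<in> cap_starts (l - 1) S"
  shows "convexifying_point m l S s"
proof -
  obtain cs where cs: "is_cap (l - 1) cs" "set cs \<subseteq> S" "hd cs = s"
    using cap by (auto simp: cap_starts_def)
  have "2 \<le> l - 1" using \<open>4 \<le> l\<close> by simp
  then obtain c es where "cs = s # c # es"
    using cap_Cons2E[OF cs(1)] cs(3) by (metis list.sel(1))
  moreover have "length cs = l - 1" using cs(1) by (simp add: is_cap_def)
  ultimately obtain d ds where ds: "cs = s # c # d # ds" "length ds = l - 4"
    using \<open>4 \<le> l\<close> by (cases es) auto
  have CS: "c \<in> S" "d \<in> S" "set ds \<subseteq> S" "s \<in> S" "q \<in> S" "set qs \<subseteq> S" using cs ds cup by auto
  have cap_c: "chain (>) (c # d # ds)" "fst s < fst c" "slope c d < slope s c"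
    using cs(1) by (auto simp: ds is_cap_iff_chain cap_Cons3)
  have cup_q: "chain (<) (qs @ [q, s])" "length qs = m - 4" "fst q < fst s"
    using cup(1) by (auto simp: is_cup_iff_chain chain_def sorted_wrt_append)
  have "\<not> slope s c < slope q s"
  proof
    assume "slope s c < slope q s"
    then have "is_cap l (q # cs)"
      using cs(1) \<open>4 \<le> l\<close> cup_q by (auto simp: ds is_cap_iff_chain cap_Cons3)
    moreover have "set (q # cs) \<subseteq> S" using CS ds by auto
    ultimately show False using S(2) unfolding cup_cap_free_def by blast
  qed
  then have qsc: "slope q s < slope s c"
    using admissible_slope_neq[OF S(1), of q s c] CS cup_q cap_c by auto
  show ?thesis
    unfolding convexifying_point_def
  proof (intro conjI allI impI)
    show "s \<in> S" by fact
    show "\<exists>ps. is_cap (l - 1) ps \<and> set ps \<subseteq> S \<and> hd ps = s" using cs by blast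
    fix n B
    assume asm: "n \<ge> 4 \<and> B \<inter> S = {} \<and> admissible (B \<union> S) \<and>
      (\<exists>ps. is_cup (n - 1) ps \<and> set ps \<subseteq> B \<union> S \<and> hd ps = s \<and> last ps \<in> B)"
    let ?cup = "\<exists>ps. is_cup m ps \<and> set ps \<subseteq> B \<union> S \<and> ps ! 0 \<in> S \<and> ps ! 1 \<in> S"
    let ?cap = "\<exists>ps. is_cap l ps \<and> set ps \<subseteq> B \<union> S \<and> ps ! (l - 2) \<in> S \<and> ps ! (l - 1) \<in> S"
    let ?gon = "contains_convex_gon n (B \<union> S)"
    from asm obtain ps where n: "4 \<le> n" and BS: "B \<inter> S = {}" and adm: "admissible (B \<union> S)"
      and ps: "is_cup (n - 1) ps" "set ps \<subseteq> B \<union> S" "hd ps = s" "last ps \<in> B" by blast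
    \<comment> \<open>The \<open>(m - 2)\<close>-cup is continued by \<open>x\<close> and
      \<open>y\<close>. As \<open>m - 2 \<ge> 2\<close>, its two leftmost points are in
      \<open>S\<close>.\<close>
    have cupI: ?cup if "x \<in> B \<union> S" "y \<in> B \<union> S" "slope q s < slope s x" "slope s x < slope x y"
      "fst s < fst x" "fst x < fst y" for x y
    proof (intro exI conjI)
      have "chain (<) ((qs @ [q]) @ [s, x, y])"
        unfolding cup_snoc3 using that cup_q by (simp add: cup_snoc3)
      then show "is_cup m (qs @ [q, s, x, y])"
        using cup_q \<open>4 \<le> m\<close> by (simp add: is_cup_iff_chain)
      show "set (qs @ [q, s, x, y]) \<subseteq> B \<union> S" using that CS by auto
      show "(qs @ [q, s, x, y]) ! 0 \<in> S" using CS by (cases qs) auto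
      show "(qs @ [q, s, x, y]) ! 1 \<in> S" using CS by (cases qs; cases "tl qs") auto
    qed
    \<comment> \<open>In the \<open>(l - 1)\<close>-cap, \<open>s\<close> is replaced by
      \<open>x\<close> and \<open>y\<close>. The remaining \<open>l - 2 \<ge> 2\<close> points are
      in \<open>S\<close>, among them the two rightmost.\<close>
    have capI: ?cap if "x \<in> B \<union> S" "y \<in> B \<union> S" "slope c d < slope y c" "slope y c < slope x y"
      "fst x < fst y" "fst y < fst c" for x y
    proof (intro exI conjI)
      show "is_cap l (x # y # c # d # ds)"
        using that cap_c \<open>4 \<le> l\<close> ds by (simp add: is_cap_iff_chain cap_Cons3)
      show "set (x # y # c # d # ds) \<subseteq> B \<union> S" using that CS by auto
      have "(c # d # ds) ! (l - 4) \<in> set (c # d # ds)" "(c # d # ds) ! (l - 3) \<in> set (c # d # ds)"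
        using ds \<open>4 \<le> l\<close> by (intro nth_mem; simp)+
      moreover have "l - 2 = Suc (Suc (l - 4))" "l - 1 = Suc (Suc (l - 3))" using \<open>4 \<le> l\<close> by auto
      ultimately show "(x # y # c # d # ds) ! (l - 2) \<in> S" "(x # y # c # d # ds) ! (l - 1) \<in> S"
        using CS by auto
    qed
    have gonI: ?gon if "T \<subseteq> B \<union> S" "card T = n" "convex_position T" for T
      using that n unfolding contains_convex_gon_def by (metis card.infinite not_numeral_le_zero)
    have "2 \<le> n - 1" using n by simp
    obtain ws y r where "ps = ws @ [y, r]" using cup_snoc2E[OF ps(1) \<open>2 \<le> n - 1\<close>] by metis
    moreover have "length ps = n - 1" using ps(1) by (simp add: is_cup_def)
    \<comment> \<open>Since \<open>n - 1 \<ge> 3\<close>, the point \<open>y\<close> is not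
      \<open>s\<close>; \<open>vs\<close> is empty exactly for \<open>n = 4\<close>.\<close>
    ultimately obtain vs where vs: "ps = s # vs @ [y, r]" "length vs = n - 4"
      using n ps(3) by (cases ws) auto
    have chain_ps: "chain (<) (s # vs @ [y, r])" using ps(1) vs by (simp add: is_cup_iff_chain)
    have mem: "y \<in> B \<union> S" "r \<in> B" "set vs \<subseteq> B \<union> S" "c \<in> B \<union> S" "s \<in> B \<union> S"
      using ps vs CS by auto
    have ord: "fst s < fst y" "fst y < fst r" "slope s y < slope y r"
      using chain_ps cup_triple[of "s # vs" y "[r]" s r]
      by (auto simp: chain_def sorted_wrt_append)
    \<comment> \<open>This is where the right end of the cup has to lie in \<open>B\<close>.\<close>
    have "r \<noteq> c" using mem CS BS by auto
    then have "fst r \<noteq> fst c" using admissible_fst_neq[OF adm] mem by auto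
    then consider "fst c < fst r" | "fst r < fst c" by linarith
    then show "?cup \<or> ?cap \<or> ?gon"
    proof cases
      case 1
      have "slope s c \<noteq> slope c r" using admissible_slope_neq[OF adm] mem cap_c 1 by auto
      then consider "slope s c < slope c r" | "slope c r < slope s c" by linarith
      then show ?thesis
      proof cases
        assume "slope s c < slope c r"
        then show ?thesis using cupI[of c r] mem qsc cap_c 1 by auto
      next
        assume above: "slope c r < slope s c"
        have pos: "convex_position (insert c (set (s # (vs @ [y]) @ [r])))"
          using chain_ps cap_c 1 above by (intro convex_position_cup_insert) auto
        \<comment> \<open>Inner points of the cup lie below the chord from \<open>s\<close> to
          \<open>r\<close>, but \<open>c\<close> lies above it, so there really are \<open>n\<close>
          points.\<close>
        have "c \<notin> set (s # (vs @ [y]) @ [r])"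
        proof
          assume "c \<in> set (s # (vs @ [y]) @ [r])"
          then have "c \<in> set (vs @ [y])" using \<open>r \<noteq> c\<close> cap_c by auto
          then obtain us zs where "vs @ [y] = us @ c # zs" by (meson split_list)
          then have "s # vs @ [y, r] = (s # us) @ c # (zs @ [r])"
            by (metis append.assoc append_Cons append_Nil)
          then have "chain (<) ((s # us) @ c # (zs @ [r]))" using chain_ps by metis
          from cup_triple[OF this, of s r] have "slope s c < slope c r" by simp
          then show False using above by auto
        qed
        then have "card (insert c (set (s # (vs @ [y]) @ [r]))) = n"
          using chain_distinct[OF chain_ps] vs n distinct_card[of "s # vs @ [y, r]"] by auto
        moreover have "insert c (set (s # (vs @ [y]) @ [r])) \<subseteq> B \<union> S" using mem by auto
        ultimately show ?thesis using gonI pos by metis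
      qed
    next
      case 2
      have sr: "fst s < fst r" using ord by simp
      have "slope s r \<noteq> slope r c" using admissible_slope_neq[OF adm] mem sr 2 by auto
      then consider "slope s r < slope r c" | "slope r c < slope s r" by linarith
      then show ?thesis
      proof cases
        assume below: "slope s r < slope r c"
        \<comment> \<open>With \<open>r\<close> below the segment from \<open>s\<close> to
          \<open>c\<close>, the edge from \<open>r\<close> into \<open>c\<close> is steeper than the
          one from \<open>s\<close>, so the turn at \<open>c\<close> remains that of a cap.\<close>
        then have scr: "slope s c < slope r c" using slope_mediant(2)[OF sr 2] by simp
        have "slope y r \<noteq> slope r c" using admissible_slope_neq[OF adm] mem ord 2 by auto
        then consider "slope y r < slope r c" | "slope r c < slope y r" by linarith
        then show ?thesis
        proof cases
          assume "slope y r < slope r c"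
          then have n_cup: "chain (<) (s # (vs @ [y, r]) @ [c])"
            using chain_ps 2 cup_snoc3[of "s # vs" y r c] by auto
          have "card (set (s # (vs @ [y, r]) @ [c])) = n"
            using distinct_card[OF chain_distinct[OF n_cup]] vs n by simp
          moreover have "set (s # (vs @ [y, r]) @ [c]) \<subseteq> B \<union> S" using mem by auto
          ultimately show ?thesis using gonI convex_position_cup[OF n_cup] by metis
        next
          assume "slope r c < slope y r"
          then show ?thesis using capI[of y r] mem ord 2 scr cap_c by auto
        qed
      next
        assume above: "slope r c < slope s r"
        then have scr: "slope s c < slope s r" using slope_mediant(3)[OF sr 2] by simp
        have "slope q s \<noteq> slope s y"
          using admissible_slope_neq[OF adm] mem CS ord cup_q by auto
        then consider "slope q s < slope s y" | "slope s y < slope q s" by linarith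
        then show ?thesis
        proof cases
          assume "slope q s < slope s y"
          then show ?thesis using cupI[of y r] mem ord by auto
        next
          assume "slope s y < slope q s"
          then have "slope s y < slope s c" using qsc by simp
          have yc: "fst y < fst c" using ord 2 by simp
          have syc: "slope s y < slope y c" "slope s c < slope y c"
            using \<open>slope s y < slope s c\<close> slope_mediant(1,2)[OF ord(1) yc] by auto
          \<comment> \<open>If \<open>c\<close> can replace \<open>r\<close> as right end of the
            \<open>(n - 1)\<close>-cup, then \<open>r\<close>, above the new chord from
            \<open>s\<close> to \<open>c\<close>, is the \<open>n\<close>-th vertex.\<close>
          have gon: ?gon if n_cup: "chain (<) (s # (vs @ [y]) @ [c])"
          proof (rule gonI)
            show "convex_position (insert r (set (s # (vs @ [y]) @ [c])))"
              using n_cup sr 2 above by (rule convex_position_cup_insert)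
            have "card (set (s # (vs @ [y]) @ [c])) = n - 1"
              using distinct_card[OF chain_distinct[OF n_cup]] vs n by simp
            moreover have "r \<notin> set (s # (vs @ [y]) @ [c])"
              using chain_distinct[OF chain_ps] \<open>r \<noteq> c\<close> by auto
            ultimately show "card (insert r (set (s # (vs @ [y]) @ [c]))) = n"
              using n by (simp add: card_insert_if del: set_append)
          qed (use mem in auto)
          \<comment> \<open>The turn at \<open>y\<close> towards \<open>c\<close> depends on the
            predecessor of \<open>y\<close>: \<open>s\<close> for \<open>n = 4\<close>, otherwise
            the last point \<open>x\<close> of \<open>vs\<close>. A left turn gives the new cup; a
            right turn lets \<open>x\<close> and \<open>y\<close> replace \<open>s\<close> in the
            cap.\<close>
          show ?thesis
          proof (cases vs rule: rev_cases)
            case Nil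
            then show ?thesis using gon syc ord yc by (auto simp: cup_Cons3)
          next
            case (snoc us x)
            have sub: "chain (<) ((s # us) @ [x, y])"
              using chain_ps chain_append(1)[of _ "(s # us) @ [x, y]" "[r]"] by (simp add: snoc)
            then have "fst x < fst y" by (auto simp: chain_def sorted_wrt_append)
            have "x \<in> B \<union> S" using mem snoc by auto
            have "slope x y \<noteq> slope y c"
              using admissible_slope_neq[OF adm] mem \<open>x \<in> B \<union> S\<close> \<open>fst x < fst y\<close> yc by auto
            then consider "slope x y < slope y c" | "slope y c < slope x y" by linarith
            then show ?thesis
            proof cases
              assume "slope x y < slope y c"
              then have "chain (<) ((s # us) @ [x, y, c])" unfolding cup_snoc3 using sub yc by simp
              then show ?thesis using gon by (simp add: snoc)
            next
              assume "slope y c < slope x y"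
              then show ?thesis
                using capI[of x y] mem \<open>x \<in> B \<union> S\<close> \<open>fst x < fst y\<close> yc syc cap_c by auto
            qed
          qed
        qed
      qed
    qed
  qed
qed

section \<open>The bound on the convexification function\<close>

theorem theorem15:
  fixes m l :: nat
  assumes "m \<ge> 4" and "l \<ge> 4"
  shows "int (convexification m l)
           \<le> int ((m + l - 4) choose (l - 2)) - int ((m + l - 6) choose (l - 3))"
proof -
  obtain a b where ab: "m = a + 4" "l = b + 4" using assms by (metis le_iff_add add.commute)
  \<comment> \<open>The summands are the Erdos-Szekeres bounds for \<open>(m - 2, l)\<close>-free
    and \<open>(m, l - 1)\<close>-free sets.\<close>
  let ?N = "((a + (b + 2)) choose (b + 2)) + (((a + 2) + (b + 1)) choose (b + 1))"
  let ?C = "{card S | S. admissible S \<and> cup_cap_free m l S \<and> \<not> (\<exists>s. convexifying_point m l S s)}"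
  have bound: "card S \<le> ?N"
    if S: "admissible S" "cup_cap_free m l S" "\<not> (\<exists>s. convexifying_point m l S s)" for S
  proof (rule card_cup_cap_free_le_cap_starts[where m = m and k = "a + 2" and l = "b + 3"])
    show "cup_cap_free m (Suc (b + 3)) S" using S ab by (simp add: eval_nat_numeral)
    show "card T \<le> (a + (b + 2)) choose (b + 2)"
      if "admissible T" "cup_cap_free (a + 2) (Suc (b + 3)) T" for T
      using erdos_szekeres_cup_cap[of T a "b + 2"] that by (simp add: eval_nat_numeral)
    show "card T \<le> ((a + 2) + (b + 1)) choose (b + 1)"
      if "admissible T" "cup_cap_free m (b + 3) T" for T
      using erdos_szekeres_cup_cap[of T "a + 2" "b + 1"] that ab by (simp add: eval_nat_numeral)
    show "\<not> set ps \<subseteq> cap_starts (b + 3) S" if ps: "is_cup (a + 2) ps" for ps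
    proof
      assume sub: "set ps \<subseteq> cap_starts (b + 3) S"
      obtain qs q s where "ps = qs @ [q, s]" using cup_snoc2E[OF ps] by (metis le_add2)
      moreover have "cap_starts (b + 3) S \<subseteq> S" by (auto simp: cap_starts_def)
      ultimately have "convexifying_point m l S s"
        using convexifying_point_if_cup_end_and_cap_start[OF S(1,2) assms, of qs q s] sub ps ab
        by (auto simp: add.commute)
      then show False using S(3) by blast
    qed
  qed (use S in auto)
  \<comment> \<open>\<open>Max\<close> requires a finite nonempty set: the bound gives finiteness,
    the empty point set a member.\<close>
  have "?C \<subseteq> {..?N}" using bound by auto
  then have "finite ?C" using finite_subset by blast
  moreover have "card ({} :: (real \<times> real) set) \<in> ?C"
    using assms
    by (intro CollectI exI[of _ "{}"])
      (auto simp: admissible_def cup_cap_free_def convexifying_point_def is_cup_def is_cap_def)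
  ultimately have "convexification m l \<le> ?N"
    unfolding convexification_def using bound by (intro Max.boundedI) auto
  \<comment> \<open>Pascal's rule, applied twice.\<close>
  moreover have "?N + ((m + l - 6) choose (l - 3)) = (m + l - 4) choose (l - 2)"
    using ab by (simp add: eval_nat_numeral)
  ultimately show ?thesis by linarith
qed

end
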